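(* Let $(M,g)$ be a generalized Kantowski-Sachs spacetime with metric $$g=dt^{2}-X^{2}(t)\,dr^{2}-Y^{2}(t)\,[d\theta^{2}+f^{2}(\theta)\,d\phi^{2}]$$ with respect to the local coordinates $(t,r,\theta,\phi)$, and let $$\widehat g=dt^{2}-\widehat X^{2}(t)\,dr^{2}-\widehat Y^{2}(t)\,[d\theta^{2}+\widehat f^{2}(\theta)\,d\phi^{2}]$$ be another metric of the same type on $M$ in the same coordinates, where $X,Y,f,\widehat X,\widehat Y,\widehat f$ are smooth functions. Then the horizontal lift metric ${}^{H}\widehat g$ on the tangent bundle $TM$ is harmonic with respect to the horizontal lift metric ${}^{H}g$ on $TM$ if and only if $$\frac{1}{X^{2}}(\widehat X'\widehat X-X'X)+\frac{1}{Y^{2}}(\widehat Y'\widehat Y-Y'Y)+\frac{1}{Y^{2}f^{2}}(\widehat Y'\widehat Y\widehat f^{2}-Y'Yf^{2})=0$$ and $$-\widehat f\,\widehat f'+f f'=0.$$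
   Context: All objects are smooth. $M$ is a 4-dimensional manifold with coordinates $(t,r,\theta,\phi)$, and $g,\widehat g$ are pseudo-Riemannian (hence nondegenerate) metrics, so $X,Y,f,\widehat X,\widehat Y,\widehat f$ are nowhere zero on the coordinate domain. Primes denote derivatives: $X',Y',\widehat X',\widehat Y'$ with respect to $t$, and $f',\widehat f'$ with respect to $\theta$. For a map $F:(M,g_1)\to(N,g_2)$ of pseudo-Riemannian manifolds, the tension field is, in local coordinates, $$\tau(F)=g_1^{ij}\Big\{\frac{\partial^2F^\gamma}{\partial x^i\partial x^j}-{}^{M}\Gamma_{ij}^k\frac{\partial F^\gamma}{\partial x^k}+{}^{N}\Gamma_{\alpha\beta}^\gamma\frac{\partial F^\alpha}{\partial x^i}\frac{\partial F^\beta}{\partial x^j}\Big\}\frac{\partial}{\partial y^\gamma},$$ where ${}^{M}\Gamma$ and ${}^{N}\Gamma$ are the Christoffel symbols of the Levi-Civita connections of $g_1$ and $g_2$; $F$ is harmonic if $\tau(F)=0$. A pseudo-Riemannian metric $d$ on a pseudo-Riemannian manifold $(N,h)$ is called harmonic with respect to $h$ if the identity map $I:(N,h)\to(N,d)$ is harmonic. Tangent bundle: coordinates $(x^i)$ on $U\subset M$ induce coordinates $(x^i,u^i)$ on $\pi^{-1}(U)\subset TM$, where $u^i$ are the components of tangent vectors with respect to $\partial/\partial x^i$. For a metric $g$ on $M$ with Levi-Civita Christoffel symbols $\Gamma_{ij}^k$ and a vector field $Z=Z^i\,\partial/\partial x^i$ on $M$, the vertical and horizontal lifts are $$Z^V=Z^i\frac{\partial}{\partial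 u^i},\qquad Z^H=Z^i\frac{\partial}{\partial x^i}-u^a\Gamma_{ak}^iZ^k\frac{\partial}{\partial u^i}.$$ The horizontal lift ${}^{H}g$ of $g$ is the metric on $TM$ defined, for all vector fields $Z,W$ on $M$, by ${}^{H}g(Z^H,W^H)=0$, ${}^{H}g(Z^H,W^V)=g(Z,W)$, ${}^{H}g(Z^V,W^V)=0$. The metric ${}^{H}\widehat g$ is the horizontal lift of $\widehat g$, defined in the same way from $\widehat g$. *)

theory Defs
  imports "HOL-Analysis.Analysis"
begin

text \<open>
  A pseudo-Riemannian manifold carrying a global coordinate system is given by an open set of
  \<open>real ^ 'n\<close> together with the matrix field of components of its metric in these coordinates.
\<close>

definition dir_deriv :: "'a::real_normed_vector \<Rightarrow> ('a \<Rightarrow> 'b::real_normed_vector) \<Rightarrow> 'a \<Rightarrow> 'b" where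
  "dir_deriv v f x = frechet_derivative f (at x) v"

text \<open>
  On an open subset of a finite-dimensional space this is membership in \<open>C\<^sup>\<infinity>\<close>: every iterated
  directional derivative exists and is differentiable, hence continuous.
\<close>

definition smooth_on :: "'a::euclidean_space set \<Rightarrow> ('a \<Rightarrow> 'b::euclidean_space) \<Rightarrow> bool" where
  "smooth_on S f \<longleftrightarrow> (\<forall>vs. \<forall>x\<in>S. foldr dir_deriv vs f differentiable (at x))"

abbreviation partial :: "'n::finite \<Rightarrow> (real ^ 'n \<Rightarrow> real) \<Rightarrow> real ^ 'n \<Rightarrow> real" where
  "partial i \<equiv> dir_deriv (axis i 1)"

definition pseudo_riemannian_metric :: "(real ^ 'n) set \<Rightarrow> (real ^ 'n \<Rightarrow> real ^ 'n ^ 'n) \<Rightarrow> bool" where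
  "pseudo_riemannian_metric U g \<longleftrightarrow>
     open U \<and> smooth_on U g \<and> (\<forall>x\<in>U. transpose (g x) = g x \<and> invertible (g x))"

definition christoffel ::
  "(real ^ 'n \<Rightarrow> real ^ 'n ^ 'n) \<Rightarrow> 'n::finite \<Rightarrow> 'n \<Rightarrow> 'n \<Rightarrow> real ^ 'n \<Rightarrow> real" where
  "christoffel g k i j x =
     1 / 2 * (\<Sum>l\<in>UNIV. matrix_inv (g x) $ k $ l *
       (partial i (\<lambda>y. g y $ j $ l) x + partial j (\<lambda>y. g y $ i $ l) x
        - partial l (\<lambda>y. g y $ i $ j) x))"

definition tension_field ::
  "(real ^ 'm \<Rightarrow> real ^ 'm ^ 'm) \<Rightarrow> (real ^ 'n \<Rightarrow> real ^ 'n ^ 'n) \<Rightarrow>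
   (real ^ 'm::finite \<Rightarrow> real ^ 'n::finite) \<Rightarrow> real ^ 'm \<Rightarrow> real ^ 'n" where
  "tension_field g1 g2 F x = (\<chi> c.
     \<Sum>i\<in>UNIV. \<Sum>j\<in>UNIV. matrix_inv (g1 x) $ i $ j *
       (partial i (partial j (\<lambda>y. F y $ c)) x
        - (\<Sum>k\<in>UNIV. christoffel g1 k i j x * partial k (\<lambda>y. F y $ c) x)
        + (\<Sum>a\<in>UNIV. \<Sum>b\<in>UNIV. christoffel g2 c a b (F x) *
             partial i (\<lambda>y. F y $ a) x * partial j (\<lambda>y. F y $ b) x)))"

definition harmonic_map ::
  "(real ^ 'm) set \<Rightarrow> (real ^ 'm \<Rightarrow> real ^ 'm ^ 'm) \<Rightarrow>
   (real ^ 'n) set \<Rightarrow> (real ^ 'n \<Rightarrow> real ^ 'n ^ 'n) \<Rightarrow>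
   (real ^ 'm::finite \<Rightarrow> real ^ 'n::finite) \<Rightarrow> bool" where
  "harmonic_map U g1 V g2 F \<longleftrightarrow>
     pseudo_riemannian_metric U g1 \<and> pseudo_riemannian_metric V g2 \<and>
     F ` U \<subseteq> V \<and> smooth_on U F \<and> (\<forall>x\<in>U. tension_field g1 g2 F x = 0)"

text \<open>\<open>harmonic_metric U h d\<close>: the metric \<open>d\<close> is harmonic with respect to \<open>h\<close>.\<close>

definition harmonic_metric ::
  "(real ^ 'n::finite) set \<Rightarrow> (real ^ 'n \<Rightarrow> real ^ 'n ^ 'n) \<Rightarrow> (real ^ 'n \<Rightarrow> real ^ 'n ^ 'n) \<Rightarrow> bool" where
  "harmonic_metric U h d \<longleftrightarrow> harmonic_map U h U d id"

text \<open>
  The induced coordinates \<open>(x\<^sup>i, u\<^sup>i)\<close> on the tangent bundle are indexed by \<open>'n + 'n\<close>: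
  \<open>x\<^sup>i\<close> has index \<open>Inl i\<close> and \<open>u\<^sup>i\<close> has index \<open>Inr i\<close>.
\<close>

definition base_point :: "real ^ ('n + 'n) \<Rightarrow> real ^ 'n::finite" where
  "base_point p = (\<chi> i. p $ Inl i)"

definition fibre_part :: "real ^ ('n + 'n) \<Rightarrow> real ^ 'n::finite" where
  "fibre_part p = (\<chi> i. p $ Inr i)"

definition tangent_bundle :: "(real ^ 'n::finite) set \<Rightarrow> (real ^ ('n + 'n)) set" where
  "tangent_bundle U = {p. base_point p \<in> U}"

definition vertical_lift :: "(real ^ 'n::finite \<Rightarrow> real ^ 'n) \<Rightarrow> real ^ ('n + 'n) \<Rightarrow> real ^ ('n + 'n)" where
  "vertical_lift Z p = (\<chi> s. case s of Inl i \<Rightarrow> 0 | Inr i \<Rightarrow> Z (base_point p) $ i)"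

definition horizontal_lift ::
  "(real ^ 'n \<Rightarrow> real ^ 'n ^ 'n) \<Rightarrow> (real ^ 'n::finite \<Rightarrow> real ^ 'n) \<Rightarrow>
   real ^ ('n + 'n) \<Rightarrow> real ^ ('n + 'n)" where
  "horizontal_lift g Z p = (\<chi> s. case s of
       Inl i \<Rightarrow> Z (base_point p) $ i
     | Inr i \<Rightarrow> - (\<Sum>a\<in>UNIV. \<Sum>k\<in>UNIV.
         fibre_part p $ a * christoffel g i a k (base_point p) * Z (base_point p) $ k))"

definition metric_at :: "real ^ 'n ^ 'n \<Rightarrow> real ^ 'n::finite \<Rightarrow> real ^ 'n \<Rightarrow> real" where
  "metric_at B v w = v \<bullet> (B *v w)"

text \<open>
  Lifts at \<open>p\<close> only involve the values of the vector fields at the base point of \<open>p\<close>, so it makes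
  no difference whether \<open>Z\<close> and \<open>W\<close> range over all or only over smooth vector fields. As the lifts
  span the tangent space at \<open>p\<close>, the symmetric matrix below is unique; it exists whenever the
  matrix of \<open>g\<close> at the base point is symmetric.
\<close>

definition horizontal_lift_metric ::
  "(real ^ 'n \<Rightarrow> real ^ 'n ^ 'n) \<Rightarrow> real ^ ('n + 'n) \<Rightarrow> real ^ ('n + 'n) ^ ('n::finite + 'n)" where
  "horizontal_lift_metric g p = (THE B. transpose B = B \<and>
     (\<forall>Z W. metric_at B (horizontal_lift g Z p) (horizontal_lift g W p) = 0 \<and>
            metric_at B (horizontal_lift g Z p) (vertical_lift W p)
              = metric_at (g (base_point p)) (Z (base_point p)) (W (base_point p)) \<and>
            metric_at B (vertical_lift Z p) (vertical_lift W p) = 0))"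

text \<open>The coordinates \<open>(t, r, \<theta>, \<phi>)\<close> are the components 1, 2, 3, 4.\<close>

definition kantowski_sachs_metric ::
  "(real \<Rightarrow> real) \<Rightarrow> (real \<Rightarrow> real) \<Rightarrow> (real \<Rightarrow> real) \<Rightarrow> real ^ 4 \<Rightarrow> real ^ 4 ^ 4" where
  "kantowski_sachs_metric X Y f x = (\<chi> i j.
     if i \<noteq> j then 0
     else if i = 1 then 1
     else if i = 2 then - (X (x $ 1))\<^sup>2
     else if i = 3 then - (Y (x $ 1))\<^sup>2
     else - (Y (x $ 1))\<^sup>2 * (f (x $ 3))\<^sup>2)"

end

theory Submission imports Defs begin

text \<open>
  Three ideas carry the proof.

  The horizontal lift of a metric with respect to its own Levi-Civita connection is the complete
  lift. With respect to the frame of horizontal and vertical lifts its blocks are \<open>[[0, g], [g, 0]]\<close>.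
  Passing to the coordinates \<open>(x, u)\<close> changes only the first of them, which becomes
  \<open>u\<^sup>a (\<Gamma>\<^bsub>i,aj\<^esub> + \<Gamma>\<^bsub>j,ai\<^esub>)\<close> with lowered Christoffel symbols, and metric compatibility turns
  this into \<open>u\<^sup>a \<partial>\<^sub>a g\<^bsub>ij\<^esub>\<close> (\<open>horizontal_lift_metric_eq_complete_lift\<close>). So in block form the lift is
  \<open>[[u\<^sup>a \<partial>\<^sub>a g, g], [g, 0]]\<close>.

  For the identity map, the tension field is the trace, with respect to the first metric, of the
  difference of the two sets of Christoffel symbols. The \<open>x\<close>-block of the inverse of a complete
  lift vanishes, so the symbols with two lower base indices, the only ones that involve second
  derivatives of \<open>g\<close>, never enter this trace. Those with two lower fibre indices vanish, and the mixed
  ones are the Christoffel symbols of the base, with a fibre index on top. The two mixed blocks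
  contribute equally, and the tension field upstairs is \<open>(0, 2 \<tau>)\<close>, where \<open>\<tau>\<close> is the tension field of
  the identity from \<open>(M, g)\<close> to \<open>(M, h)\<close>. Thus for all metrics \<open>g\<close> and \<open>h\<close> the lift of \<open>h\<close> is harmonic
  with respect to the lift of \<open>g\<close> exactly if \<open>h\<close> is harmonic with respect to \<open>g\<close>
  (\<open>harmonic_metric_horizontal_lift_metric_iff\<close>).

  Kantowski-Sachs metrics are diagonal, hence only symbols with equal lower indices are traced.
  The \<open>r\<close>- and \<open>\<phi>\<close>-components of \<open>\<tau>\<close> vanish because nothing depends on \<open>r\<close> and \<open>\<phi>\<close>; the
  \<open>t\<close>-component is minus the first expression of the theorem, and the \<open>\<theta>\<close>-component is the second one
  divided by \<open>- Y\<^sup>2 f\<^sup>2\<close> (\<open>tension_field_kantowski_sachs\<close>).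
\<close>

section \<open>Smooth functions\<close>

lemma dir_deriv_eqI:
  assumes "(f has_derivative f') (at x)"
  shows "dir_deriv v f x = f' v"
  using frechet_derivative_at[OF assms] by (simp add: dir_deriv_def)

lemma has_derivative_dir_deriv:
  "f differentiable (at x) \<Longrightarrow> (f has_derivative (\<lambda>v. dir_deriv v f x)) (at x)"
  by (simp add: dir_deriv_def frechet_derivative_works)

lemma dir_deriv_cong:
  assumes "open S" "x \<in> S" "\<And>y. y \<in> S \<Longrightarrow> f y = g y"
  shows "dir_deriv v f x = dir_deriv v g x"
proof -
  have "(f has_derivative f') (at x) \<longleftrightarrow> (g has_derivative f') (at x)" for f'
    using assms has_derivative_transform_within_open[of f f' x UNIV S g]
      has_derivative_transform_within_open[of g f' x UNIV S f] by auto
  then show ?thesis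
    by (simp add: dir_deriv_def frechet_derivative_def)
qed

lemma differentiable_cong_open:
  assumes "open S" "x \<in> S" "\<And>y. y \<in> S \<Longrightarrow> f y = g y" "f differentiable (at x)"
  shows "g differentiable (at x)"
  using assms has_derivative_transform_within_open[of f _ x UNIV S g]
  unfolding differentiable_def by auto

text \<open>
  Counting derivatives makes induction possible: the derivative of a product involves the factors
  themselves as well as their derivatives, so the induction has to pass from \<open>n + 1\<close> to \<open>n\<close>
  derivatives of the same function.
\<close>

primrec times_differentiable_on ::
  "nat \<Rightarrow> 'a::real_normed_vector set \<Rightarrow> ('a \<Rightarrow> 'b::real_normed_vector) \<Rightarrow> bool" where
  "times_differentiable_on 0 S f \<longleftrightarrow> (\<forall>x\<in>S. f differentiable (at x))"
| "times_differentiable_on (Suc n) S f \<longleftrightarrow>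
     (\<forall>x\<in>S. f differentiable (at x)) \<and> (\<forall>v. times_differentiable_on n S (dir_deriv v f))"

text \<open>
  The recursion peels off the derivative that is taken first, which is the last element of the list.
\<close>

lemma times_differentiable_on_iff_foldr:
  "times_differentiable_on n S f \<longleftrightarrow>
     (\<forall>vs. length vs \<le> n \<longrightarrow> (\<forall>x\<in>S. foldr dir_deriv vs f differentiable (at x)))"
proof (induction n arbitrary: f)
  case 0
  then show ?case by simp
next
  case (Suc n)
  have "(\<forall>vs. length vs \<le> Suc n \<longrightarrow> P vs) \<longleftrightarrow> P [] \<and> (\<forall>v vs. length vs \<le> n \<longrightarrow> P (vs @ [v]))"
    for P :: "'a list \<Rightarrow> bool"
  proof safe
    fix vs :: "'a list"
    assume "P []" "\<forall>v vs. length vs \<le> n \<longrightarrow> P (vs @ [v])" "length vs \<le> Suc n"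
    then show "P vs" by (cases vs rule: rev_cases) auto
  qed auto
  then show ?case by (simp add: Suc.IH)
qed

lemma smooth_on_iff_times_differentiable_on:
  "smooth_on S f \<longleftrightarrow> (\<forall>n. times_differentiable_on n S f)"
  unfolding smooth_on_def times_differentiable_on_iff_foldr by blast

lemma times_differentiable_on_cong:
  assumes "open S" "times_differentiable_on n S f" "\<And>x. x \<in> S \<Longrightarrow> f x = g x"
  shows "times_differentiable_on n S g"
  using assms(2,3)
proof (induction n arbitrary: f g)
  case 0
  have "g differentiable (at x)" if "x \<in> S" for x
    by (rule differentiable_cong_open[OF assms(1) that, of f]) (use 0 that in simp_all)
  then show ?case by simp
next
  case (Suc n)
  have "times_differentiable_on n S (dir_deriv v g)" for v
    by (rule Suc.IH[of "dir_deriv v f"], use Suc.prems(1) in simp,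
        rule dir_deriv_cong[OF assms(1)], assumption, rule Suc.prems(2))
  moreover have "g differentiable (at x)" if "x \<in> S" for x
    by (rule differentiable_cong_open[OF assms(1) that, of f]) (use Suc.prems that in simp_all)
  ultimately show ?case by simp
qed

lemma times_differentiable_on_Suc:
  "times_differentiable_on (Suc n) S f \<Longrightarrow> times_differentiable_on n S f"
  by (simp add: times_differentiable_on_iff_foldr)

lemma times_differentiable_on_linear_compose:
  assumes "open S" "bounded_linear L" "times_differentiable_on n S f"
  shows "times_differentiable_on n S (\<lambda>x. L (f x))"
proof -
  have linear: "(\<lambda>x. L (f x)) differentiable (at x)" if "f differentiable (at x)"
    for f :: "'a \<Rightarrow> 'b" and x
    using that bounded_linear.has_derivative[OF assms(2)] unfolding differentiable_def by blast
  show ?thesis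
    using assms(3)
  proof (induction n arbitrary: f)
    case 0
    then show ?case
      by (simp add: linear)
  next
    case (Suc n)
    have *: "dir_deriv v (\<lambda>x. L (f x)) x = L (dir_deriv v f x)" if "x \<in> S" for v x
      by (rule dir_deriv_eqI, rule bounded_linear.has_derivative[OF assms(2)],
          rule has_derivative_dir_deriv) (use that Suc.prems in simp)
    have "times_differentiable_on n S (dir_deriv v (\<lambda>x. L (f x)))" for v
      by (rule times_differentiable_on_cong[OF assms(1) Suc.IH[of "dir_deriv v f"]])
        (use * Suc.prems in auto)
    then show ?case using Suc.prems linear by simp
  qed
qed

lemma times_differentiable_on_add:
  assumes "open S" "times_differentiable_on n S f" "times_differentiable_on n S g"
  shows "times_differentiable_on n S (\<lambda>x. f x + g x)"
  using assms(2,3)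
proof (induction n arbitrary: f g)
  case 0
  then show ?case by simp
next
  case (Suc n)
  have *: "dir_deriv v (\<lambda>x. f x + g x) x = dir_deriv v f x + dir_deriv v g x" if "x \<in> S" for v x
    by (rule dir_deriv_eqI, rule has_derivative_add; rule has_derivative_dir_deriv)
      (use that Suc.prems in simp_all)
  have "times_differentiable_on n S (dir_deriv v (\<lambda>x. f x + g x))" for v
    by (rule times_differentiable_on_cong[OF assms(1) Suc.IH[of "dir_deriv v f" "dir_deriv v g"]])
      (use * Suc.prems in auto)
  then show ?case using Suc.prems by simp
qed

lemma times_differentiable_on_mult:
  fixes f g :: "'a::real_normed_vector \<Rightarrow> real"
  assumes "open S" "times_differentiable_on n S f" "times_differentiable_on n S g"
  shows "times_differentiable_on n S (\<lambda>x. f x * g x)"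
  using assms(2,3)
proof (induction n arbitrary: f g)
  case 0
  then show ?case by simp
next
  case (Suc n)
  have *: "dir_deriv v (\<lambda>x. f x * g x) x = f x * dir_deriv v g x + dir_deriv v f x * g x"
    if "x \<in> S" for v x
    by (rule dir_deriv_eqI, rule has_derivative_mult; rule has_derivative_dir_deriv)
      (use that Suc.prems in simp_all)
  have "times_differentiable_on n S (dir_deriv v (\<lambda>x. f x * g x))" for v
    by (rule times_differentiable_on_cong[OF assms(1)
          times_differentiable_on_add[OF assms(1) Suc.IH[of f "dir_deriv v g"] Suc.IH[of "dir_deriv v f" g]]])
      (use * Suc.prems times_differentiable_on_Suc[of n S] in simp_all)
  then show ?case using Suc.prems by simp
qed

text \<open>
  Only linear substitutions are needed, as the projection of the tangent bundle is linear in induced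
  coordinates. For these the chain rule keeps the shape of the function: a derivative of \<open>f \<circ> L\<close> in
  direction \<open>v\<close> is a derivative of \<open>f\<close> in the fixed direction \<open>L v\<close>, composed with \<open>L\<close>.
\<close>

lemma times_differentiable_on_compose_linear:
  assumes "bounded_linear L" "times_differentiable_on n S f" "open S"
  shows "times_differentiable_on n (L -` S) (\<lambda>x. f (L x))"
  using assms(2)
proof (induction n arbitrary: f)
  case 0
  then show ?case
    using bounded_linear_imp_differentiable[OF assms(1)] differentiable_chain_at[of L _ f]
    by (simp add: o_def)
next
  case (Suc n)
  have *: "((\<lambda>x. f (L x)) has_derivative (\<lambda>v. dir_deriv (L v) f (L x))) (at x)" if "L x \<in> S" for x
    by (rule diff_chain_at[OF bounded_linear_imp_has_derivative[OF assms(1)], unfolded o_def],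
        rule has_derivative_dir_deriv) (use that Suc.prems in simp)
  have "open (L -` S)"
    using assms(3) by (intro open_vimage linear_continuous_on[OF assms(1)])
  then have "times_differentiable_on n (L -` S) (dir_deriv v (\<lambda>x. f (L x)))" for v
    by (rule times_differentiable_on_cong[OF _ Suc.IH[of "dir_deriv (L v) f"]])
      (use Suc.prems dir_deriv_eqI[OF *] in simp_all)
  moreover have "(\<lambda>x. f (L x)) differentiable (at x)" if "L x \<in> S" for x
    using *[OF that] unfolding differentiable_def by blast
  ultimately show ?case by simp
qed

lemma smooth_on_cong:
  assumes "open S" "smooth_on S f" "\<And>x. x \<in> S \<Longrightarrow> f x = g x"
  shows "smooth_on S g"
  using assms times_differentiable_on_cong unfolding smooth_on_iff_times_differentiable_on by blast

lemma smooth_on_dir_deriv: "smooth_on S f \<Longrightarrow> smooth_on S (dir_deriv v f)"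
  unfolding smooth_on_iff_times_differentiable_on by (metis times_differentiable_on.simps(2))

lemma smooth_on_imp_differentiable: "smooth_on S f \<Longrightarrow> x \<in> S \<Longrightarrow> f differentiable (at x)"
  unfolding smooth_on_iff_times_differentiable_on by (metis times_differentiable_on.simps(1))

lemma smooth_on_linear_compose:
  "open S \<Longrightarrow> bounded_linear L \<Longrightarrow> smooth_on S f \<Longrightarrow> smooth_on S (\<lambda>x. L (f x))"
  unfolding smooth_on_iff_times_differentiable_on using times_differentiable_on_linear_compose by blast

lemma smooth_on_compose_linear:
  "open S \<Longrightarrow> bounded_linear L \<Longrightarrow> smooth_on S f \<Longrightarrow> smooth_on (L -` S) (\<lambda>x. f (L x))"
  unfolding smooth_on_iff_times_differentiable_on using times_differentiable_on_compose_linear by blast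

lemma smooth_on_add:
  "open S \<Longrightarrow> smooth_on S f \<Longrightarrow> smooth_on S g \<Longrightarrow> smooth_on S (\<lambda>x. f x + g x)"
  unfolding smooth_on_iff_times_differentiable_on using times_differentiable_on_add by blast

lemma smooth_on_mult:
  fixes f g :: "'a::euclidean_space \<Rightarrow> real"
  shows "open S \<Longrightarrow> smooth_on S f \<Longrightarrow> smooth_on S g \<Longrightarrow> smooth_on S (\<lambda>x. f x * g x)"
  unfolding smooth_on_iff_times_differentiable_on using times_differentiable_on_mult by blast

lemma smooth_on_const: "smooth_on S (\<lambda>x. c)"
proof -
  have "times_differentiable_on n S (\<lambda>x. c)" for n and c :: 'b
    by (induction n arbitrary: c) (auto simp: dir_deriv_def[abs_def])
  then show ?thesis unfolding smooth_on_iff_times_differentiable_on by blast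
qed

lemma smooth_on_bounded_linear:
  assumes "bounded_linear L"
  shows "smooth_on S L"
proof -
  have "dir_deriv v L = (\<lambda>x. L v)" for v
    using dir_deriv_eqI[OF bounded_linear_imp_has_derivative[OF assms]] by blast
  moreover have "times_differentiable_on n S (\<lambda>x. L v)" for n v
    using smooth_on_const unfolding smooth_on_iff_times_differentiable_on by blast
  ultimately have "times_differentiable_on n S L" for n
    using bounded_linear_imp_differentiable[OF assms] by (cases n) auto
  then show ?thesis unfolding smooth_on_iff_times_differentiable_on by blast
qed

lemma smooth_on_sum:
  assumes "open S" "\<And>i. i \<in> I \<Longrightarrow> smooth_on S (f i)"
  shows "smooth_on S (\<lambda>x. \<Sum>i\<in>I. f i x)"
  using assms(2)
  by (induction I rule: infinite_finite_induct) (auto simp: smooth_on_const smooth_on_add[OF assms(1)])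

lemma bounded_linear_axis: "bounded_linear (axis i :: 'b::euclidean_space \<Rightarrow> 'b ^ 'n)"
  by (rule linear_conv_bounded_linear[THEN iffD1], rule linearI) (simp_all add: axis_def vec_eq_iff)

lemma smooth_on_vec:
  fixes f :: "'n::finite \<Rightarrow> 'a::euclidean_space \<Rightarrow> 'b::euclidean_space"
  assumes "open S" "\<And>i. smooth_on S (f i)"
  shows "smooth_on S (\<lambda>x. \<chi> i. f i x)"
proof -
  have "(\<chi> i. f i x) = (\<Sum>i\<in>UNIV. axis i (f i x))" for x
    by (simp add: vec_eq_iff axis_def sum_component)
  then show ?thesis
    by (simp add: smooth_on_sum smooth_on_linear_compose assms bounded_linear_axis)
qed

section \<open>Inverse matrices and Christoffel symbols\<close>

lemma matrix_inv_eqI: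
  fixes A B :: "real ^ 'n ^ 'n"
  assumes "A ** B = mat 1"
  shows "matrix_inv A = B"
proof -
  have "B ** A = mat 1" using assms matrix_left_right_inverse by blast
  then have "\<exists>C. A ** C = mat 1 \<and> C ** A = mat 1" using assms by blast
  then have "A ** matrix_inv A = mat 1" "matrix_inv A ** A = mat 1"
    unfolding matrix_inv_def by (metis (mono_tags, lifting) someI_ex)+
  then show ?thesis
    by (metis assms matrix_mul_assoc matrix_mul_lid matrix_mul_rid)
qed

lemma matrix_inv_right:
  fixes A :: "real ^ 'n ^ 'n"
  assumes "invertible A"
  shows "A ** matrix_inv A = mat 1"
  using assms matrix_inv_eqI unfolding invertible_def by blast

lemma partial_metric_sym:
  assumes "pseudo_riemannian_metric U g" "x \<in> U"
  shows "partial l (\<lambda>y. g y $ i $ j) x = partial l (\<lambda>y. g y $ j $ i) x"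
  by (rule dir_deriv_cong[of U])
    (use assms in \<open>auto simp: pseudo_riemannian_metric_def transpose_def vec_eq_iff\<close>)

text \<open>
  Multiplication by \<open>g\<close> cancels the inverse matrix in the definition of the Christoffel symbols.
\<close>

lemma christoffel_lowered:
  assumes "pseudo_riemannian_metric U g" "x \<in> U"
  shows "(\<Sum>k\<in>UNIV. g x $ l $ k * christoffel g k i j x) =
    1 / 2 * (partial i (\<lambda>y. g y $ j $ l) x + partial j (\<lambda>y. g y $ i $ l) x
      - partial l (\<lambda>y. g y $ i $ j) x)"
proof -
  define c where "c m = partial i (\<lambda>y. g y $ j $ m) x + partial j (\<lambda>y. g y $ i $ m) x
      - partial m (\<lambda>y. g y $ i $ j) x" for m
  have "g x ** matrix_inv (g x) = mat 1"
    using assms by (intro matrix_inv_right) (auto simp: pseudo_riemannian_metric_def)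
  then have inv: "(\<Sum>k\<in>UNIV. g x $ l $ k * matrix_inv (g x) $ k $ m) = (if l = m then 1 else 0)" for m
    by (simp add: vec_eq_iff matrix_matrix_mult_def mat_def)
  have "(\<Sum>k\<in>UNIV. g x $ l $ k * christoffel g k i j x)
      = (\<Sum>k\<in>UNIV. \<Sum>m\<in>UNIV. 1 / 2 * c m * (g x $ l $ k * matrix_inv (g x) $ k $ m))"
    by (simp add: christoffel_def c_def[symmetric] sum_distrib_left mult_ac)
  also have "\<dots> = (\<Sum>m\<in>UNIV. 1 / 2 * c m * (\<Sum>k\<in>UNIV. g x $ l $ k * matrix_inv (g x) $ k $ m))"
    by (subst sum.swap) (simp add: sum_distrib_left)
  also have "\<dots> = 1 / 2 * c l"
    by (simp add: inv if_distrib cong: if_cong)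
  finally show ?thesis by (simp add: c_def)
qed

text \<open>
  The Levi-Civita connection is metric: in the sum of the two lowered symbols the derivatives of the
  other components cancel.
\<close>

lemma metric_compatible:
  assumes "pseudo_riemannian_metric U g" "x \<in> U"
  shows "(\<Sum>k\<in>UNIV. g x $ i $ k * christoffel g k a j x) +
    (\<Sum>k\<in>UNIV. g x $ j $ k * christoffel g k a i x) = partial a (\<lambda>y. g y $ i $ j) x"
  using partial_metric_sym[OF assms, of a i j] partial_metric_sym[OF assms, of i a j]
    partial_metric_sym[OF assms, of j a i]
  by (simp only: christoffel_lowered[OF assms]) (simp add: field_simps)

text \<open>
  The coordinate functions of the identity have constant first and zero second derivatives, so that
  only the difference of the two connections is traced.
\<close>

lemma tension_field_id:
  "tension_field g1 g2 id x $ c =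
     (\<Sum>i\<in>UNIV. \<Sum>j\<in>UNIV. matrix_inv (g1 x) $ i $ j * (christoffel g2 c i j x - christoffel g1 c i j x))"
proof -
  have d: "partial k (\<lambda>y. y $ c) = (\<lambda>x. if k = c then 1 else 0)" for k c :: 'a
    by (rule ext, rule dir_deriv_eqI[THEN trans], rule bounded_linear_imp_has_derivative,
        rule bounded_linear_vec_nth) (simp add: axis_def)
  have dd: "partial k (\<lambda>x. r) x = 0" for k :: 'a and r :: real
    by (simp add: dir_deriv_def)
  have delta: "(\<Sum>a\<in>UNIV. \<Sum>b\<in>UNIV. h a b * (if i = a then 1 else 0) * (if j = b then 1 else 0)) = h i j"
    for h :: "'a \<Rightarrow> 'a \<Rightarrow> real" and i j
  proof -
    have "(\<Sum>b\<in>UNIV. h a b * (if i = a then 1 else 0) * (if j = b then 1 else 0)) =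
        (if i = a then h a j else 0)" for a
      by (cases "i = a") (simp_all add: if_distrib[of "(*) _"] cong: if_cong)
    then show ?thesis by simp
  qed
  show ?thesis
    unfolding tension_field_def
    by (simp add: d dd delta) (simp add: if_distrib[of "(*) _"] cong: if_cong)
qed

section \<open>The horizontal lift is the complete lift\<close>

lemma sum_UNIV_sum:
  "(\<Sum>s\<in>UNIV. h s) = (\<Sum>i\<in>UNIV. h (Inl i)) + (\<Sum>i\<in>UNIV. h (Inr i))"
  for h :: "'a::finite + 'b::finite \<Rightarrow> 'c::comm_monoid_add"
  using sum.Plus[of "UNIV :: 'a set" "UNIV :: 'b set" h] by (simp add: o_def)

text \<open>
  The complete lift of tensor calculus. It needs no connection, so that its components are simple
  enough to be differentiated.
\<close>

definition complete_lift ::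
  "(real ^ 'n \<Rightarrow> real ^ 'n ^ 'n) \<Rightarrow> real ^ ('n + 'n) \<Rightarrow> real ^ ('n + 'n) ^ ('n::finite + 'n)" where
  "complete_lift g p = (\<chi> s t. case s of
       Inl i \<Rightarrow> (case t of
           Inl j \<Rightarrow> (\<Sum>a\<in>UNIV. fibre_part p $ a * partial a (\<lambda>y. g y $ i $ j) (base_point p))
         | Inr j \<Rightarrow> g (base_point p) $ i $ j)
     | Inr i \<Rightarrow> (case t of Inl j \<Rightarrow> g (base_point p) $ i $ j | Inr j \<Rightarrow> 0))"

lemma complete_lift_nth [simp]:
  "complete_lift g p $ Inl i $ Inl j =
     (\<Sum>a\<in>UNIV. fibre_part p $ a * partial a (\<lambda>y. g y $ i $ j) (base_point p))"
  "complete_lift g p $ Inl i $ Inr j = g (base_point p) $ i $ j"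
  "complete_lift g p $ Inr i $ Inl j = g (base_point p) $ i $ j"
  "complete_lift g p $ Inr i $ Inr j = 0"
  by (simp_all add: complete_lift_def)

lemma base_point_nth [simp]: "base_point p $ i = p $ Inl i"
  and fibre_part_nth [simp]: "fibre_part p $ i = p $ Inr i"
  by (simp_all add: base_point_def fibre_part_def)

lemma vec_eq_parts: "base_point v = base_point w \<Longrightarrow> fibre_part v = fibre_part w \<Longrightarrow> v = w"
  unfolding vec_eq_iff base_point_nth fibre_part_nth by (metis sum.exhaust)

lemma bounded_linear_base_point: "bounded_linear base_point"
  by (rule linear_conv_bounded_linear[THEN iffD1], rule linearI) (simp_all add: vec_eq_iff)

lemma tangent_bundle_vimage: "tangent_bundle U = base_point -` U"
  by (auto simp: tangent_bundle_def)

lemma open_tangent_bundle: "open U \<Longrightarrow> open (tangent_bundle U)"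
  unfolding tangent_bundle_vimage
  by (intro open_vimage linear_continuous_on bounded_linear_base_point)

lemma metric_at_complete_lift:
  "metric_at (complete_lift g p) v w =
     base_point v \<bullet> ((\<chi> i j. complete_lift g p $ Inl i $ Inl j) *v base_point w) +
     base_point v \<bullet> (g (base_point p) *v fibre_part w) +
     fibre_part v \<bullet> (g (base_point p) *v base_point w)"
  by (simp add: metric_at_def inner_vec_def matrix_vector_mult_def sum_UNIV_sum sum.distrib
      distrib_left del: complete_lift_nth(1))

text \<open>
  The matrix \<open>N\<close> with \<open>Z\<^sup>H = (Z, - N Z)\<close>.
\<close>

definition connection_matrix ::
  "(real ^ 'n \<Rightarrow> real ^ 'n ^ 'n) \<Rightarrow> real ^ ('n + 'n) \<Rightarrow> real ^ 'n ^ ('n::finite)" where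
  "connection_matrix g p = (\<chi> i k. \<Sum>a\<in>UNIV. fibre_part p $ a * christoffel g i a k (base_point p))"

lemma lift_parts [simp]:
  "base_point (horizontal_lift g Z p) = Z (base_point p)"
  "fibre_part (horizontal_lift g Z p) = - (connection_matrix g p *v Z (base_point p))"
  "base_point (vertical_lift W p) = 0"
  "fibre_part (vertical_lift W p) = W (base_point p)"
proof -
  show "fibre_part (horizontal_lift g Z p) = - (connection_matrix g p *v Z (base_point p))"
    unfolding vec_eq_iff horizontal_lift_def connection_matrix_def matrix_vector_mult_def
    by (simp add: sum_distrib_right) (intro allI, rule sum.swap)
qed (simp_all add: vec_eq_iff horizontal_lift_def vertical_lift_def)

text \<open>
  In coordinates, horizontal vectors are orthogonal to each other exactly if the base block is
  \<open>g N + N\<^sup>T g\<close>. This is the place where metric compatibility enters.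
\<close>

lemma complete_lift_base_block:
  assumes "pseudo_riemannian_metric U g" "p \<in> tangent_bundle U"
  shows "(\<chi> i j. complete_lift g p $ Inl i $ Inl j) =
    g (base_point p) ** connection_matrix g p +
    transpose (connection_matrix g p) ** g (base_point p)"
proof -
  define x where "x = base_point p"
  have x: "x \<in> U" using assms by (simp add: tangent_bundle_def x_def)
  have l: "(g x ** connection_matrix g p) $ i $ j =
      (\<Sum>a\<in>UNIV. p $ Inr a * (\<Sum>k\<in>UNIV. g x $ i $ k * christoffel g k a j x))" for i j
    by (simp add: connection_matrix_def matrix_matrix_mult_def sum_distrib_left x_def[symmetric] mult_ac)
      (rule sum.swap)
  have r: "transpose (connection_matrix g p) ** g x = transpose (g x ** connection_matrix g p)"
    using assms(1) x by (simp add: matrix_transpose_mul pseudo_riemannian_metric_def)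
  show ?thesis
    unfolding vec_eq_iff x_def[symmetric] r
    by (simp add: transpose_def l flip: metric_compatible[OF assms(1) x] x_def)
      (simp add: sum.distrib distrib_left)
qed

lemma inner_matrix_vector_transpose:
  fixes A :: "real ^ 'n ^ 'm"
  shows "(A *v v) \<bullet> w = v \<bullet> (transpose A *v w)"
  by (metis dot_lmul_matrix vector_transpose_matrix)

lemma metric_at_axis: "metric_at B (axis s 1) (axis t 1) = B $ s $ t"
  by (simp add: metric_at_def inner_axis' matrix_vector_mul_component inner_axis)

lemma metric_at_add:
  "metric_at B (v + v') w = metric_at B v w + metric_at B v' w"
  "metric_at B v (w + w') = metric_at B v w + metric_at B v w'"
  by (simp_all add: metric_at_def inner_add_left inner_add_right matrix_vector_right_distrib)

lemma metric_at_transpose: "metric_at (transpose B) v w = metric_at B w v"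
  unfolding metric_at_def by (metis inner_matrix_vector_transpose inner_commute)

text \<open>
  The property that the definition of the horizontal lift metric singles out by definite description.
\<close>

definition is_horizontal_lift_metric where
  "is_horizontal_lift_metric g p B \<longleftrightarrow> transpose B = B \<and>
     (\<forall>Z W. metric_at B (horizontal_lift g Z p) (horizontal_lift g W p) = 0 \<and>
            metric_at B (horizontal_lift g Z p) (vertical_lift W p)
              = metric_at (g (base_point p)) (Z (base_point p)) (W (base_point p)) \<and>
            metric_at B (vertical_lift Z p) (vertical_lift W p) = 0)"

lemma complete_lift_is_horizontal_lift_metric:
  assumes "pseudo_riemannian_metric U g" "p \<in> tangent_bundle U"
  shows "is_horizontal_lift_metric g p (complete_lift g p)"
proof -
  define x where "x = base_point p"
  have x: "x \<in> U" using assms by (simp add: tangent_bundle_def x_def)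
  have sym: "transpose (g x) = g x"
    using assms(1) x by (auto simp: pseudo_riemannian_metric_def)
  have "complete_lift g p $ s $ t = complete_lift g p $ t $ s" for s t
    using sym partial_metric_sym[OF assms(1) x] by (cases s; cases t)
      (auto simp: x_def[symmetric] transpose_def vec_eq_iff)
  then have 1: "transpose (complete_lift g p) = complete_lift g p"
    by (simp add: transpose_def vec_eq_iff)
  let ?N = "connection_matrix g p"
  have "(?N *v v) \<bullet> (g x *v w) = v \<bullet> ((transpose ?N ** g x) *v w)" for v w
    by (simp add: inner_matrix_vector_transpose matrix_vector_mul_assoc)
  then have 2: "metric_at (complete_lift g p) (horizontal_lift g Z p) (horizontal_lift g W p) = 0" for Z W
    by (simp add: metric_at_complete_lift complete_lift_base_block[OF assms] x_def[symmetric]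
        matrix_vector_mult_add_rdistrib inner_add_right matrix_vector_mul_assoc
        linear_neg[OF matrix_vector_mul_linear] del: complete_lift_nth)
  show ?thesis
    unfolding is_horizontal_lift_metric_def
    using 1 2 by (simp add: metric_at_complete_lift) (simp add: metric_at_def)
qed

text \<open>
  Every tangent vector of the bundle is the sum of a horizontal and a vertical lift of constant vector
  fields, and the four conditions fix the values on all pairs of lifts.
\<close>

lemma horizontal_lift_metric_unique:
  assumes "is_horizontal_lift_metric g p B" "is_horizontal_lift_metric g p C"
  shows "B = C"
proof -
  \<comment> \<open>the vertical part of \<open>v\<close>: its fibre part without that of the horizontal lift of \<open>base_point v\<close>\<close>
  define V where "V v = fibre_part v + connection_matrix g p *v base_point v" for v
  have split: "v = horizontal_lift g (\<lambda>_. base_point v) p + vertical_lift (\<lambda>_. V v) p" for v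
  proof -
    have "base_point (horizontal_lift g (\<lambda>_. base_point v) p + vertical_lift (\<lambda>_. V v) p) = base_point v"
      by (simp add: linear_add[OF bounded_linear.linear[OF bounded_linear_base_point]])
    moreover have "fibre_part (horizontal_lift g (\<lambda>_. base_point v) p + vertical_lift (\<lambda>_. V v) p)
       = fibre_part (horizontal_lift g (\<lambda>_. base_point v) p) + fibre_part (vertical_lift (\<lambda>_. V v) p)"
      by (simp only: vec_eq_iff fibre_part_nth vector_add_component) simp
    ultimately show ?thesis
      by (simp add: V_def) (metis (no_types, lifting) vec_eq_parts)
  qed
  have "metric_at D v w = metric_at (g (base_point p)) (base_point v) (V w) +
      metric_at (g (base_point p)) (base_point w) (V v)"
    if D: "is_horizontal_lift_metric g p D" for D v w
  proof -
    have sym: "metric_at D v w = metric_at D w v" for v w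
      using metric_at_transpose[of D] D unfolding is_horizontal_lift_metric_def by metis
    show ?thesis
      by (subst split[of v], subst split[of w], unfold metric_at_add)
        (use D sym[of "vertical_lift _ p" "horizontal_lift g _ p"] in
          \<open>simp add: is_horizontal_lift_metric_def\<close>)
  qed
  with assms have "metric_at B v w = metric_at C v w" for v w by metis
  then show ?thesis unfolding vec_eq_iff metric_at_axis[symmetric] by blast
qed

theorem horizontal_lift_metric_eq_complete_lift:
  assumes "pseudo_riemannian_metric U g" "p \<in> tangent_bundle U"
  shows "horizontal_lift_metric g p = complete_lift g p"
  unfolding horizontal_lift_metric_def is_horizontal_lift_metric_def[symmetric]
  using complete_lift_is_horizontal_lift_metric[OF assms] horizontal_lift_metric_unique by blast

section \<open>The complete lift is a pseudo-Riemannian metric\<close>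

text \<open>
  The inverse has blocks \<open>[[0, h], [h, C]]\<close>, where \<open>C = - h A h\<close> for the base block \<open>A\<close> of the
  lift. The zero block is what keeps second derivatives of \<open>g\<close> out of the tension field.
\<close>

lemma matrix_inv_complete_lift:
  assumes "pseudo_riemannian_metric U g" "p \<in> tangent_bundle U"
  defines "h \<equiv> matrix_inv (g (base_point p))"
  shows "invertible (complete_lift g p)"
    "matrix_inv (complete_lift g p) $ Inl i $ Inl j = 0"
    "matrix_inv (complete_lift g p) $ Inl i $ Inr j = h $ i $ j"
    "matrix_inv (complete_lift g p) $ Inr i $ Inl j = h $ i $ j"
proof -
  define G where "G = g (base_point p)"
  define A where "A = (\<chi> i j. complete_lift g p $ Inl i $ Inl j)"
  \<comment> \<open>the solution of \<open>A h + G C = 0\<close>, which the product of the lift with its inverse requires\<close>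
  define C where "C = - (h ** (A ** h))"
  define B :: "real ^ ('a + 'a) ^ ('a + 'a)" where "B = (\<chi> s t. case s of
      Inl i \<Rightarrow> (case t of Inl j \<Rightarrow> 0 | Inr j \<Rightarrow> h $ i $ j)
    | Inr i \<Rightarrow> (case t of Inl j \<Rightarrow> h $ i $ j | Inr j \<Rightarrow> C $ i $ j))"
  have B [simp]: "B $ Inl i $ Inl j = 0" "B $ Inl i $ Inr j = h $ i $ j"
    "B $ Inr i $ Inl j = h $ i $ j" "B $ Inr i $ Inr j = C $ i $ j" for i j
    by (simp_all add: B_def)
  have inv: "G ** h = mat 1"
    using assms by (simp add: matrix_inv_right pseudo_riemannian_metric_def tangent_bundle_def G_def)
  then have "G ** C = - (A ** h)"
  proof -
    have "G ** C = - (G ** (h ** (A ** h)))"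
      unfolding C_def by (simp add: vec_eq_iff matrix_matrix_mult_def sum_negf)
    also have "G ** (h ** (A ** h)) = A ** h"
      by (simp add: matrix_mul_assoc inv)
    finally show ?thesis .
  qed
  then have GC: "(\<Sum>k\<in>UNIV. G $ i $ k * C $ k $ j) = - (\<Sum>k\<in>UNIV. A $ i $ k * h $ k $ j)" for i j
    by (simp add: vec_eq_iff matrix_matrix_mult_def)
  have Gh: "(\<Sum>k\<in>UNIV. G $ i $ k * h $ k $ j) = (if i = j then 1 else 0)" for i j
    using inv by (simp add: vec_eq_iff matrix_matrix_mult_def mat_def)
  have comp: "complete_lift g p $ Inl i $ Inl j = A $ i $ j"
    "complete_lift g p $ Inl i $ Inr j = G $ i $ j"
    "complete_lift g p $ Inr i $ Inl j = G $ i $ j" for i j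
    by (simp_all add: A_def G_def)
  have "(complete_lift g p ** B) $ s $ t = mat 1 $ s $ t" for s t
    by (cases s; cases t) (simp_all add: matrix_matrix_mult_def mat_def sum_UNIV_sum comp GC Gh
        del: complete_lift_nth(1-3))
  then have "complete_lift g p ** B = mat 1" by (simp add: vec_eq_iff)
  from matrix_inv_eqI[OF this] this show "invertible (complete_lift g p)"
    "matrix_inv (complete_lift g p) $ Inl i $ Inl j = 0"
    "matrix_inv (complete_lift g p) $ Inl i $ Inr j = h $ i $ j"
    "matrix_inv (complete_lift g p) $ Inr i $ Inl j = h $ i $ j"
    using invertible_right_inverse by (auto simp: B)
qed

lemma smooth_on_metric_component:
  assumes "pseudo_riemannian_metric U g"
  shows "smooth_on U (\<lambda>x. g x $ i $ j)"
proof -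
  have "bounded_linear (\<lambda>M :: real ^ 'a ^ 'a. M $ i $ j)"
    by (intro bounded_linear_compose[OF bounded_linear_vec_nth] bounded_linear_vec_nth)
  then show ?thesis
    using assms by (auto simp: pseudo_riemannian_metric_def intro: smooth_on_linear_compose)
qed

lemma smooth_on_complete_lift:
  assumes "pseudo_riemannian_metric U g"
  shows "smooth_on (tangent_bundle U) (complete_lift g)"
proof -
  have o: "open U" "open (tangent_bundle U)"
    using assms open_tangent_bundle by (auto simp: pseudo_riemannian_metric_def)
  have base: "smooth_on (tangent_bundle U) (\<lambda>p. F (base_point p))"
    if "smooth_on U F" for F :: "real ^ 'a \<Rightarrow> real"
    unfolding tangent_bundle_vimage by (rule smooth_on_compose_linear[OF o(1) bounded_linear_base_point that])
  have "smooth_on (tangent_bundle U) (\<lambda>p. complete_lift g p $ s $ t)" for s t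
    by (cases s; cases t; simp)
      (intro smooth_on_sum smooth_on_mult o base smooth_on_dir_deriv smooth_on_metric_component[OF assms]
        smooth_on_bounded_linear bounded_linear_vec_nth smooth_on_const)+
  then have "smooth_on (tangent_bundle U) (\<lambda>p. \<chi> s t. complete_lift g p $ s $ t)"
    by (intro smooth_on_vec o)
  then show ?thesis by simp
qed

lemma pseudo_riemannian_metric_cong:
  assumes "pseudo_riemannian_metric U g" "\<And>x. x \<in> U \<Longrightarrow> g x = h x"
  shows "pseudo_riemannian_metric U h"
  using assms smooth_on_cong[of U g h] by (auto simp: pseudo_riemannian_metric_def)

lemma pseudo_riemannian_metric_horizontal_lift_metric:
  assumes "pseudo_riemannian_metric U g"
  shows "pseudo_riemannian_metric (tangent_bundle U) (horizontal_lift_metric g)"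
proof (rule pseudo_riemannian_metric_cong)
  show "pseudo_riemannian_metric (tangent_bundle U) (complete_lift g)"
    using assms open_tangent_bundle smooth_on_complete_lift[OF assms] matrix_inv_complete_lift(1)[OF assms]
      complete_lift_is_horizontal_lift_metric[OF assms]
    by (auto simp: pseudo_riemannian_metric_def is_horizontal_lift_metric_def)
qed (simp add: horizontal_lift_metric_eq_complete_lift[OF assms])

section \<open>Christoffel symbols and tension fields on the tangent bundle\<close>

lemma dir_deriv_compose_base_point:
  assumes "F differentiable (at (base_point p))"
  shows "dir_deriv v (\<lambda>q. F (base_point q)) p = dir_deriv (base_point v) F (base_point p)"
  by (rule dir_deriv_eqI, rule diff_chain_at[OF bounded_linear_imp_has_derivative, unfolded o_def,
        OF bounded_linear_base_point has_derivative_dir_deriv[OF assms]])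

lemma base_point_axis [simp]:
  "base_point (axis (Inl i) 1) = axis i 1" "base_point (axis (Inr i) 1) = 0"
  by (simp_all add: vec_eq_iff axis_def)

lemma dir_deriv_zero: "F differentiable (at x) \<Longrightarrow> dir_deriv 0 F x = 0"
  using linear_0[OF has_derivative_linear[OF has_derivative_dir_deriv]] by blast

text \<open>
  The lift depends on the fibre coordinates only through its base block, and linearly there, so that
  the derivative in direction \<open>u\<^sup>k\<close> gives back \<open>\<partial>\<^sub>k g\<close>.
\<close>

lemma partial_complete_lift:
  assumes "pseudo_riemannian_metric U g" "p \<in> tangent_bundle U"
  shows "partial (Inl k) (\<lambda>q. complete_lift g q $ Inl i $ Inr j) p = partial k (\<lambda>y. g y $ i $ j) (base_point p)"
    "partial (Inl k) (\<lambda>q. complete_lift g q $ Inr i $ Inl j) p = partial k (\<lambda>y. g y $ i $ j) (base_point p)"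
    "partial s (\<lambda>q. complete_lift g q $ Inr i $ Inr j) p = 0"
    "partial (Inr k) (\<lambda>q. complete_lift g q $ Inl i $ Inr j) p = 0"
    "partial (Inr k) (\<lambda>q. complete_lift g q $ Inr i $ Inl j) p = 0"
    "partial (Inr k) (\<lambda>q. complete_lift g q $ Inl i $ Inl j) p = partial k (\<lambda>y. g y $ i $ j) (base_point p)"
proof -
  have x: "base_point p \<in> U" using assms(2) by (simp add: tangent_bundle_def)
  have d: "(\<lambda>y. g y $ i $ j) differentiable (at (base_point p))"
    "partial a (\<lambda>y. g y $ i $ j) differentiable (at (base_point p))" for i j a
    using smooth_on_imp_differentiable[OF _ x] smooth_on_metric_component[OF assms(1)] smooth_on_dir_deriv
    by blast+
  show "partial (Inl k) (\<lambda>q. complete_lift g q $ Inl i $ Inr j) p = partial k (\<lambda>y. g y $ i $ j) (base_point p)"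
    "partial (Inl k) (\<lambda>q. complete_lift g q $ Inr i $ Inl j) p = partial k (\<lambda>y. g y $ i $ j) (base_point p)"
    "partial (Inr k) (\<lambda>q. complete_lift g q $ Inl i $ Inr j) p = 0"
    "partial (Inr k) (\<lambda>q. complete_lift g q $ Inr i $ Inl j) p = 0"
    using dir_deriv_compose_base_point[OF d(1)] dir_deriv_zero[OF d(1)] by simp_all
  show "partial s (\<lambda>q. complete_lift g q $ Inr i $ Inr j) p = 0"
    by (simp add: dir_deriv_def)
  have axis: "(axis (Inr k) 1 :: real ^ ('a + 'a)) $ Inr a = (if a = k then 1 else 0)" for a
    by (simp add: axis_def)
  have 0: "((\<lambda>q. partial a (\<lambda>y. g y $ i $ j) (base_point q)) has_derivative
      (\<lambda>v. dir_deriv (base_point v) (partial a (\<lambda>y. g y $ i $ j)) (base_point p))) (at p)" for a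
    by (rule diff_chain_at[OF bounded_linear_imp_has_derivative, unfolded o_def,
        OF bounded_linear_base_point has_derivative_dir_deriv[OF d(2)]])
  have "((\<lambda>q. complete_lift g q $ Inl i $ Inl j) has_derivative
      (\<lambda>v. \<Sum>a\<in>UNIV. p $ Inr a * dir_deriv (base_point v) (partial a (\<lambda>y. g y $ i $ j)) (base_point p)
         + v $ Inr a * partial a (\<lambda>y. g y $ i $ j) (base_point p))) (at p)"
    by simp (intro has_derivative_sum has_derivative_mult 0
        bounded_linear_imp_has_derivative bounded_linear_vec_nth)
  from dir_deriv_eqI[OF this] axis
  show "partial (Inr k) (\<lambda>q. complete_lift g q $ Inl i $ Inl j) p = partial k (\<lambda>y. g y $ i $ j) (base_point p)"
    by (simp add: dir_deriv_zero[OF d(2)] if_distrib[of "\<lambda>r. r * _"] cong: if_cong)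
qed

lemma christoffel_cong:
  assumes "open U" "x \<in> U" "\<And>y. y \<in> U \<Longrightarrow> g y = h y"
  shows "christoffel g k i j x = christoffel h k i j x"
proof -
  have "partial s (\<lambda>y. g y $ i $ j) x = partial s (\<lambda>y. h y $ i $ j) x" for s i j
    by (rule dir_deriv_cong[OF assms(1,2)]) (simp add: assms(3))
  then show ?thesis using assms(2,3) by (simp add: christoffel_def)
qed

text \<open>
  In the lowered symbol with lower indices \<open>x\<^sup>i\<close> and \<open>u\<^sup>j\<close> the fibre components vanish, and the
  base components are the lowered symbols of \<open>g\<close>. The inverse matrix, whose base block is zero, moves
  them to the fibre components of the raised symbol.
\<close>

lemma christoffel_complete_lift:
  assumes "pseudo_riemannian_metric U g" "p \<in> tangent_bundle U"
  shows "christoffel (complete_lift g) s (Inr i) (Inr j) p = 0"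
    "christoffel (complete_lift g) (Inl k) (Inl i) (Inr j) p = 0"
    "christoffel (complete_lift g) (Inr k) (Inl i) (Inr j) p = christoffel g k i j (base_point p)"
    "christoffel (complete_lift g) (Inl k) (Inr i) (Inl j) p = 0"
    "christoffel (complete_lift g) (Inr k) (Inr i) (Inl j) p = christoffel g k i j (base_point p)"
  by (simp_all add: christoffel_def sum_UNIV_sum partial_complete_lift[OF assms]
      matrix_inv_complete_lift[OF assms] del: complete_lift_nth)

text \<open>
  The factor 2 counts the two mixed blocks of the inverse matrix.
\<close>

lemma tension_field_horizontal_lift_metric:
  assumes g: "pseudo_riemannian_metric U g" and h: "pseudo_riemannian_metric U h"
    and p: "p \<in> tangent_bundle U"
  shows "tension_field (horizontal_lift_metric g) (horizontal_lift_metric h) id p $ Inl k = 0"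
    "tension_field (horizontal_lift_metric g) (horizontal_lift_metric h) id p $ Inr k =
       2 * tension_field g h id (base_point p) $ k"
proof -
  have o: "open (tangent_bundle U)"
    using g open_tangent_bundle by (auto simp: pseudo_riemannian_metric_def)
  have "christoffel (horizontal_lift_metric g) c s t p = christoffel (complete_lift g) c s t p"
    "christoffel (horizontal_lift_metric h) c s t p = christoffel (complete_lift h) c s t p" for c s t
    using horizontal_lift_metric_eq_complete_lift g h by (auto intro!: christoffel_cong[OF o p])
  then show "tension_field (horizontal_lift_metric g) (horizontal_lift_metric h) id p $ Inl k = 0"
    "tension_field (horizontal_lift_metric g) (horizontal_lift_metric h) id p $ Inr k =
       2 * tension_field g h id (base_point p) $ k"
    by (simp_all add: tension_field_id sum_UNIV_sum christoffel_complete_lift[OF g p]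
        christoffel_complete_lift[OF h p] matrix_inv_complete_lift[OF g p]
        horizontal_lift_metric_eq_complete_lift[OF g p])
qed

theorem harmonic_metric_horizontal_lift_metric_iff:
  assumes g: "pseudo_riemannian_metric U g" and h: "pseudo_riemannian_metric U h"
  shows "harmonic_metric (tangent_bundle U) (horizontal_lift_metric g) (horizontal_lift_metric h)
    \<longleftrightarrow> (\<forall>x\<in>U. tension_field g h id x = 0)"
proof -
  have smooth: "smooth_on (tangent_bundle U) id"
    by (rule smooth_on_bounded_linear) (simp add: id_def)
  have tension: "tension_field (horizontal_lift_metric g) (horizontal_lift_metric h) id p = 0 \<longleftrightarrow>
      tension_field g h id (base_point p) = 0" if "p \<in> tangent_bundle U" for p
  proof -
    have "v = 0 \<longleftrightarrow> w = 0" if "\<And>k. v $ Inl k = 0" "\<And>k. v $ Inr k = 2 * w $ k"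
      for v :: "real ^ ('a + 'a)" and w
      using that unfolding vec_eq_iff by (metis mult_eq_0_iff old.sum.exhaust zero_index zero_neq_numeral)
    from this[OF tension_field_horizontal_lift_metric[OF g h that]] show ?thesis .
  qed
  \<comment> \<open>the zero vector lies over every base point\<close>
  have surj: "\<exists>p. base_point p = x" for x :: "real ^ 'a"
    by (rule exI[of _ "\<chi> s. case s of Inl i \<Rightarrow> x $ i | Inr i \<Rightarrow> 0"]) (simp add: vec_eq_iff)
  have "harmonic_metric (tangent_bundle U) (horizontal_lift_metric g) (horizontal_lift_metric h)
    \<longleftrightarrow> (\<forall>p\<in>tangent_bundle U. tension_field g h id (base_point p) = 0)"
    using pseudo_riemannian_metric_horizontal_lift_metric[OF g]
      pseudo_riemannian_metric_horizontal_lift_metric[OF h] smooth tension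
    unfolding harmonic_metric_def harmonic_map_def by simp
  also have "\<dots> \<longleftrightarrow> (\<forall>x\<in>U. tension_field g h id x = 0)"
    unfolding tangent_bundle_def mem_Collect_eq Ball_def by (metis surj)
  finally show ?thesis .
qed

section \<open>Generalized Kantowski-Sachs metrics\<close>

lemma diagonal_matrix_inv:
  fixes A :: "real ^ 'n ^ 'n"
  assumes "invertible A" "\<And>i j. i \<noteq> j \<Longrightarrow> A $ i $ j = 0"
  shows "A $ i $ i \<noteq> 0" "matrix_inv A $ i $ j = (if i = j then 1 / A $ i $ i else 0)"
proof -
  have "(\<Sum>k\<in>UNIV. A $ i $ k * matrix_inv A $ k $ j) =
      (\<Sum>k\<in>UNIV. if k = i then A $ i $ i * matrix_inv A $ i $ j else 0)" for i j
    by (rule sum.cong) (use assms(2) in auto)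
  then have "(A ** matrix_inv A) $ i $ j = A $ i $ i * matrix_inv A $ i $ j" for i j
    by (simp add: matrix_matrix_mult_def)
  then have *: "A $ i $ i * matrix_inv A $ i $ j = (if i = j then 1 else 0)" for i j
    unfolding matrix_inv_right[OF assms(1)] by (simp add: mat_def)
  from *[of i i] show "A $ i $ i \<noteq> 0" by auto
  with *[of i j] show "matrix_inv A $ i $ j = (if i = j then 1 / A $ i $ i else 0)"
    by (simp add: field_simps split: if_splits)
qed

text \<open>
  The trace with respect to a diagonal metric involves no other symbols than these.
\<close>

lemma christoffel_diagonal:
  assumes g: "pseudo_riemannian_metric U g" and diag: "\<And>x i j. i \<noteq> j \<Longrightarrow> g x $ i $ j = 0"
    and x: "x \<in> U"
  shows "christoffel g k i i x = 1 / (2 * g x $ k $ k) *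
    ((if k = i then 2 * partial i (\<lambda>y. g y $ i $ i) x else 0) - partial k (\<lambda>y. g y $ i $ i) x)"
proof -
  have inv: "matrix_inv (g x) $ k $ l = (if k = l then 1 / g x $ k $ k else 0)" for l
    using g x diag by (intro diagonal_matrix_inv) (auto simp: pseudo_riemannian_metric_def)
  have "christoffel g k i i x =
      1 / (2 * g x $ k $ k) * (2 * partial i (\<lambda>y. g y $ i $ k) x - partial k (\<lambda>y. g y $ i $ i) x)"
    by (simp add: christoffel_def inv if_distrib[of "\<lambda>r. r * _"] cong: if_cong)
  moreover have "partial i (\<lambda>y. g y $ i $ k) x = 0" if "k \<noteq> i"
    using diag[of i k] that by (simp add: dir_deriv_def)
  ultimately show ?thesis by (cases "k = i") simp_all
qed

lemma tension_field_id_diagonal: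
  assumes g: "pseudo_riemannian_metric U g" and diag: "\<And>x i j. i \<noteq> j \<Longrightarrow> g x $ i $ j = 0"
    and x: "x \<in> U"
  shows "tension_field g h id x $ k =
    (\<Sum>i\<in>UNIV. (christoffel h k i i x - christoffel g k i i x) / g x $ i $ i)"
proof -
  have inv: "matrix_inv (g x) $ i $ l = (if i = l then 1 / g x $ i $ i else 0)" for i l
    using g x diag by (intro diagonal_matrix_inv) (auto simp: pseudo_riemannian_metric_def)
  show ?thesis
    by (simp add: tension_field_id inv if_distrib[of "\<lambda>r. r * _"] cong: if_cong)
qed

lemma kantowski_sachs_metric_nth:
  "i \<noteq> j \<Longrightarrow> kantowski_sachs_metric X Y f x $ i $ j = 0"
  "kantowski_sachs_metric X Y f x $ 1 $ 1 = 1"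
  "kantowski_sachs_metric X Y f x $ 2 $ 2 = - (X (x $ 1))\<^sup>2"
  "kantowski_sachs_metric X Y f x $ 3 $ 3 = - (Y (x $ 1))\<^sup>2"
  "kantowski_sachs_metric X Y f x $ 4 $ 4 = - (Y (x $ 1))\<^sup>2 * (f (x $ 3))\<^sup>2"
  by (simp_all add: kantowski_sachs_metric_def)

lemma partial_kantowski_sachs_metric:
  assumes "X differentiable (at (x $ 1))" "Y differentiable (at (x $ 1))" "f differentiable (at (x $ 3))"
  defines "D \<equiv> \<lambda>k i. partial k (\<lambda>y. kantowski_sachs_metric X Y f y $ i $ i) x"
  shows "D k 1 = 0"
    "D k 2 = (if k = 1 then - 2 * X (x $ 1) * deriv X (x $ 1) else 0)"
    "D k 3 = (if k = 1 then - 2 * Y (x $ 1) * deriv Y (x $ 1) else 0)"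
    "D k 4 = (if k = 1 then - 2 * Y (x $ 1) * deriv Y (x $ 1) * (f (x $ 3))\<^sup>2
      else if k = 3 then - 2 * (Y (x $ 1))\<^sup>2 * f (x $ 3) * deriv f (x $ 3) else 0)"
proof -
  have chain: "((\<lambda>y. F (y $ i)) has_derivative (\<lambda>v. deriv F (x $ i) * v $ i)) (at x)"
    if "F differentiable (at (x $ i))" for F :: "real \<Rightarrow> real" and i :: 4
    using diff_chain_at[OF bounded_linear_imp_has_derivative[OF bounded_linear_vec_nth],
        of F "(*) (deriv F (x $ i))" x i] that
    by (simp add: o_def has_field_derivative_def DERIV_deriv_iff_real_differentiable[symmetric])
  note d = chain[OF assms(1)] chain[OF assms(2)] chain[OF assms(3)]
  show "D k 1 = 0"
    unfolding D_def kantowski_sachs_metric_nth by (simp add: dir_deriv_def)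
  show "D k 2 = (if k = 1 then - 2 * X (x $ 1) * deriv X (x $ 1) else 0)"
    unfolding D_def kantowski_sachs_metric_nth
    by (rule dir_deriv_eqI[THEN trans], rule has_derivative_minus[OF has_derivative_power[OF d(1)]])
      (simp add: axis_def)
  show "D k 3 = (if k = 1 then - 2 * Y (x $ 1) * deriv Y (x $ 1) else 0)"
    unfolding D_def kantowski_sachs_metric_nth
    by (rule dir_deriv_eqI[THEN trans], rule has_derivative_minus[OF has_derivative_power[OF d(2)]])
      (simp add: axis_def)
  show "D k 4 = (if k = 1 then - 2 * Y (x $ 1) * deriv Y (x $ 1) * (f (x $ 3))\<^sup>2
      else if k = 3 then - 2 * (Y (x $ 1))\<^sup>2 * f (x $ 3) * deriv f (x $ 3) else 0)"
    unfolding D_def kantowski_sachs_metric_nth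
    by (rule dir_deriv_eqI[THEN trans],
        rule has_derivative_mult[OF has_derivative_minus[OF has_derivative_power[OF d(2)]]
          has_derivative_power[OF d(3)]])
      (simp add: axis_def)
qed

text \<open>
  No component \<open>g\<^bsub>ii\<^esub>\<close> depends on \<open>x\<^sup>i\<close>, hence the symbol with upper index \<open>k\<close> and lower indices \<open>i, i\<close> is
  \<open>- \<partial>\<^sub>k g\<^bsub>ii\<^esub> / (2 g\<^bsub>kk\<^esub>)\<close>. For \<open>k = t\<close> the three functions \<open>g\<^bsub>rr\<^esub>\<close>, \<open>g\<^bsub>\<theta>\<theta>\<^esub>\<close>, \<open>g\<^bsub>\<phi>\<phi>\<^esub>\<close> contribute, for \<open>k = \<theta>\<close> only
  \<open>g\<^bsub>\<phi>\<phi>\<^esub>\<close>; there the factor \<open>Y\<^sup>2\<close> cancels against \<open>g\<^bsub>\<theta>\<theta>\<^esub>\<close> in each of the two metrics, which is why \<open>\<tau>\<^sup>\<theta>\<close>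
  does not involve the scale functions except through the trace. Nondegeneracy of the metrics
  makes all denominators nonzero.
\<close>

lemma tension_field_kantowski_sachs:
  fixes U :: "(real ^ 4) set"
  assumes diff: "X differentiable (at t)" "Y differentiable (at t)" "f differentiable (at \<theta>)"
    "Xh differentiable (at t)" "Yh differentiable (at t)" "fh differentiable (at \<theta>)"
    and g: "pseudo_riemannian_metric U (kantowski_sachs_metric X Y f)"
    and h: "pseudo_riemannian_metric U (kantowski_sachs_metric Xh Yh fh)"
    and x: "x \<in> U" "x $ 1 = t" "x $ 3 = \<theta>"
  defines "\<tau> \<equiv> tension_field (kantowski_sachs_metric X Y f) (kantowski_sachs_metric Xh Yh fh) id x"
  shows "\<tau> $ 1 = - (1 / (X t)\<^sup>2 * (deriv Xh t * Xh t - deriv X t * X t)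
      + 1 / (Y t)\<^sup>2 * (deriv Yh t * Yh t - deriv Y t * Y t)
      + 1 / ((Y t)\<^sup>2 * (f \<theta>)\<^sup>2)
          * (deriv Yh t * Yh t * (fh \<theta>)\<^sup>2 - deriv Y t * Y t * (f \<theta>)\<^sup>2))"
    "\<tau> $ 2 = 0"
    "\<tau> $ 3 = - (1 / ((Y t)\<^sup>2 * (f \<theta>)\<^sup>2)) * (- (fh \<theta> * deriv fh \<theta>) + f \<theta> * deriv f \<theta>)"
    "\<tau> $ 4 = 0"
    "Y t \<noteq> 0" "f \<theta> \<noteq> 0"
proof -
  have nz: "kantowski_sachs_metric X Y f x $ i $ i \<noteq> 0"
     "kantowski_sachs_metric Xh Yh fh x $ i $ i \<noteq> 0" for i
    by (rule diagonal_matrix_inv(1)[OF _ kantowski_sachs_metric_nth(1)],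
        use g h x(1) in \<open>simp_all add: pseudo_riemannian_metric_def\<close>)+
  note nonzero = nz(1)[of 2] nz(1)[of 4] nz(2)[of 2] nz(2)[of 4]
  note symbols = christoffel_diagonal[OF g kantowski_sachs_metric_nth(1) x(1)]
    christoffel_diagonal[OF h kantowski_sachs_metric_nth(1) x(1)]
    partial_kantowski_sachs_metric[OF diff(1-3)[folded x(2,3)]]
    partial_kantowski_sachs_metric[OF diff(4-6)[folded x(2,3)]]
  have tension: "\<tau> $ k = (\<Sum>i\<in>UNIV. (christoffel (kantowski_sachs_metric Xh Yh fh) k i i x
      - christoffel (kantowski_sachs_metric X Y f) k i i x) / kantowski_sachs_metric X Y f x $ i $ i)" for k
    unfolding \<tau>_def by (rule tension_field_id_diagonal[OF g _ x(1)]) (rule kantowski_sachs_metric_nth(1))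
  show "Y t \<noteq> 0" "f \<theta> \<noteq> 0"
    using nonzero by (simp_all add: kantowski_sachs_metric_nth x(2,3))
  show "\<tau> $ 1 = - (1 / (X t)\<^sup>2 * (deriv Xh t * Xh t - deriv X t * X t)
      + 1 / (Y t)\<^sup>2 * (deriv Yh t * Yh t - deriv Y t * Y t)
      + 1 / ((Y t)\<^sup>2 * (f \<theta>)\<^sup>2)
          * (deriv Yh t * Yh t * (fh \<theta>)\<^sup>2 - deriv Y t * Y t * (f \<theta>)\<^sup>2))"
    "\<tau> $ 2 = 0" "\<tau> $ 4 = 0"
    "\<tau> $ 3 = - (1 / ((Y t)\<^sup>2 * (f \<theta>)\<^sup>2)) * (- (fh \<theta> * deriv fh \<theta>) + f \<theta> * deriv f \<theta>)"
    using nonzero unfolding tension sum_4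
    by (simp_all add: symbols x(2,3))
      (simp_all add: kantowski_sachs_metric_nth x(2,3) field_simps)
qed

theorem theorem4:
  fixes U :: "(real ^ 4) set"
    and X Y f Xh Yh fh :: "real \<Rightarrow> real"
  assumes "open U"
    and "smooth_on ((\<lambda>x. x $ 1) ` U) X" "smooth_on ((\<lambda>x. x $ 1) ` U) Y"
    and "smooth_on ((\<lambda>x. x $ 3) ` U) f"
    and "smooth_on ((\<lambda>x. x $ 1) ` U) Xh" "smooth_on ((\<lambda>x. x $ 1) ` U) Yh"
    and "smooth_on ((\<lambda>x. x $ 3) ` U) fh"
    and "pseudo_riemannian_metric U (kantowski_sachs_metric X Y f)"
    and "pseudo_riemannian_metric U (kantowski_sachs_metric Xh Yh fh)"
  shows "harmonic_metric (tangent_bundle U)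
           (horizontal_lift_metric (kantowski_sachs_metric X Y f))
           (horizontal_lift_metric (kantowski_sachs_metric Xh Yh fh)) \<longleftrightarrow>
         (\<forall>x\<in>U. let t = x $ 1; \<theta> = x $ 3 in
            1 / (X t)\<^sup>2 * (deriv Xh t * Xh t - deriv X t * X t)
            + 1 / (Y t)\<^sup>2 * (deriv Yh t * Yh t - deriv Y t * Y t)
            + 1 / ((Y t)\<^sup>2 * (f \<theta>)\<^sup>2)
                * (deriv Yh t * Yh t * (fh \<theta>)\<^sup>2 - deriv Y t * Y t * (f \<theta>)\<^sup>2) = 0) \<and>
         (\<forall>x\<in>U. let \<theta> = x $ 3 in - (fh \<theta> * deriv fh \<theta>) + f \<theta> * deriv f \<theta> = 0)"
proof -
  have "tension_field (kantowski_sachs_metric X Y f) (kantowski_sachs_metric Xh Yh fh) id x = 0 \<longleftrightarrow>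
      1 / (X t)\<^sup>2 * (deriv Xh t * Xh t - deriv X t * X t)
        + 1 / (Y t)\<^sup>2 * (deriv Yh t * Yh t - deriv Y t * Y t)
        + 1 / ((Y t)\<^sup>2 * (f \<theta>)\<^sup>2)
            * (deriv Yh t * Yh t * (fh \<theta>)\<^sup>2 - deriv Y t * Y t * (f \<theta>)\<^sup>2) = 0 \<and>
      - (fh \<theta> * deriv fh \<theta>) + f \<theta> * deriv f \<theta> = 0"
    if "x \<in> U" "x $ 1 = t" "x $ 3 = \<theta>" for x t \<theta>
  proof -
    have "t \<in> (\<lambda>x. x $ 1) ` U" "\<theta> \<in> (\<lambda>x. x $ 3) ` U" using that by auto
    note \<tau> = tension_field_kantowski_sachs[OF
        smooth_on_imp_differentiable[OF assms(2) this(1)]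
        smooth_on_imp_differentiable[OF assms(3) this(1)]
        smooth_on_imp_differentiable[OF assms(4) this(2)]
        smooth_on_imp_differentiable[OF assms(5) this(1)]
        smooth_on_imp_differentiable[OF assms(6) this(1)]
        smooth_on_imp_differentiable[OF assms(7) this(2)]
        assms(8,9) that]
    have "- (1 / ((Y t)\<^sup>2 * (f \<theta>)\<^sup>2)) \<noteq> 0" using \<tau>(5,6) by simp
    then show ?thesis
      unfolding vec_eq_iff forall_4 zero_index \<tau>(1-4) neg_equal_0_iff_equal mult_eq_0_iff[of "- (1 / _)"]
      by blast
  qed
  then show ?thesis
    unfolding harmonic_metric_horizontal_lift_metric_iff[OF assms(8,9)] Let_def by auto
qed

end
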